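(* Let $n\ge1$ and $\widetilde\rho>0$ be fixed. For small values of $k$ (i.e. for all $k\ne0$ with $|k|$ sufficiently small) one has $$E_{q,B}<E_c<E_{q,F};\qquad S_{q,B}<S_c<S_{q,F}\ \text{ for } n>2;\qquad F_{q,F}<F_c<F_{q,B}.$$ That is, for sufficiently small $k>0$: $E(M_k)<E(M_0)$, $F(M_k)>F(M_0)$, and $S(M_k)<S(M_0)$ if $n>2$; and for $k<0$ with $|k|$ sufficiently small: $E(M_k)>E(M_0)$, $F(M_k)<F(M_0)$, and $S(M_k)>S(M_0)$ if $n>2$.
   Context: $\Omega\subset\mathbb{R}^n$ is a bounded domain of volume $V_\Omega$, and $\widetilde\rho>0$ is a fixed total density. For $k\in\mathbb{R}$ with $|k|$ small, $C_k$ denotes the unique constant with $C_k>0$, $kC_k<1$ and $$V_\Omega\int_{\mathbb{R}^n}\frac{C_k e^{-|v|^2/2}}{1-kC_ke^{-|v|^2/2}}\,dv=\widetilde\rho,$$ and $M_k(v)=\dfrac{C_ke^{-|v|^2/2}}{1-kC_ke^{-|v|^2/2}}$. Set $\Phi(f)=f\log f$ for $k=0$ and $\Phi(f)=f\log f-\frac1k(1+kf)\log(1+kf)+f$ for $k\ne0$. Then $S(M_k)=-\int_\Omega\int_{\mathbb{R}^n}\Phi(M_k)\,dv\,dx$ (with $\Phi$ corresponding to the same $k$), $E(M_k)=\int_\Omega\int_{\mathbb{R}^n}\frac{|v|^2}{2}M_k\,dv\,dx$, and $F(M_k)=S(M_k)-E(M_k)$. The subscript $c$ (classical) refers to $k=0$,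 the subscripts $q,B$ (boson) to $k>0$ and $q,F$ (fermion) to $k<0$. *)

theory Defs
  imports "HOL-Analysis.Analysis"
begin

text \<open>
  Distribution functions are f :: real^'n \<Rightarrow> real^'n \<Rightarrow> real, applied to the position x and then
  to the velocity v. All integrals are Lebesgue (Bochner) integrals.
\<close>

definition maxwellian :: "real \<Rightarrow> real \<Rightarrow> real^'n \<Rightarrow> real" where
  "maxwellian k C v =
     C * exp (- (norm v)\<^sup>2 / 2) / (1 - k * C * exp (- (norm v)\<^sup>2 / 2))"

text \<open>
  The integral of a non-integrable function is 0, so for a positive density the mass equation
  below forces the profile to be integrable. The definite description is only meaningful for
  those k (among them all k close to 0) for which the constant exists and is unique.
\<close>

definition mass_const :: "(real^'n) set \<Rightarrow> real \<Rightarrow> real \<Rightarrow> real" where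
  "mass_const \<Omega> \<rho> k =
     (THE C. C > 0 \<and> k * C < 1 \<and>
        measure lborel \<Omega> * (LINT v|(lborel :: (real^'n) measure). maxwellian k C v) = \<rho>)"

definition equilibrium :: "(real^'n) set \<Rightarrow> real \<Rightarrow> real \<Rightarrow> real^'n \<Rightarrow> real^'n \<Rightarrow> real" where
  "equilibrium \<Omega> \<rho> k = (\<lambda>x v. maxwellian k (mass_const \<Omega> \<rho> k) v)"

definition entropy_density :: "real \<Rightarrow> real \<Rightarrow> real" where
  "entropy_density k f =
     (if k = 0 then f * ln f
      else f * ln f - (1 / k) * (1 + k * f) * ln (1 + k * f) + f)"

definition entropy :: "(real^'n) set \<Rightarrow> real \<Rightarrow> (real^'n \<Rightarrow> real^'n \<Rightarrow> real) \<Rightarrow> real" where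
  "entropy \<Omega> k f = - (LINT x:\<Omega>|lborel. (LINT v|lborel. entropy_density k (f x v)))"

definition energy :: "(real^'n) set \<Rightarrow> (real^'n \<Rightarrow> real^'n \<Rightarrow> real) \<Rightarrow> real" where
  "energy \<Omega> f = (LINT x:\<Omega>|lborel. (LINT v|lborel. (norm v)\<^sup>2 / 2 * f x v))"

text \<open>
  The sign convention is entropy minus energy, i.e. the negative of the usual free energy.
\<close>

definition free_energy :: "(real^'n) set \<Rightarrow> real \<Rightarrow> (real^'n \<Rightarrow> real^'n \<Rightarrow> real) \<Rightarrow> real" where
  "free_energy \<Omega> k f = entropy \<Omega> k f - energy \<Omega> f"

end

theory Submission
  imports "HOL-Probability.Distributions" Defs
begin

text \<open>
  Put \<open>u = k C\<close>, where \<open>C\<close> is the mass constant of \<open>k\<close>, and \<open>g = exp (- |v|\<^sup>2 / 2)\<close>, so that the equilibrium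
  is \<open>C g / (1 - u g)\<close>. Let \<open>G u\<close> and \<open>L u\<close> be the integrals of \<open>g / (1 - u g)\<close> and of
  \<open>|v|\<^sup>2 / 2 * g / (1 - u g)\<close>, and let \<open>K u\<close> be the integral of \<open>- ln (1 - u g) / u\<close>,
  read as \<open>g\<close> when \<open>u = 0\<close>. The mass equation reads
  \<open>C * G u = \<rho> / V\<close>. Eliminating \<open>C\<close> gives

    \<^item> energy: \<open>\<rho> * L / G\<close>;
    \<^item> free energy: \<open>\<rho> * (ln G + K / G - ln (\<rho> / V) - 1)\<close>;
    \<^item> entropy: the sum of the two.

  All three depend on \<open>k\<close> only through \<open>u\<close>, which has the sign of \<open>k\<close> and tends to \<open>0\<close> with \<open>k\<close>
  (\<open>mass_const_near_0\<close>). It therefore suffices to know the signs of the derivatives at \<open>u = 0\<close>.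
  With \<open>a = G 0\<close> and \<open>d = 2 powr (- n / 2)\<close>, Gaussian scaling gives
  \<open>G' = a d\<close>, \<open>L 0 = n a / 2\<close>, \<open>L' = n a d / 4\<close>, \<open>K 0 = a\<close>, \<open>K' = a d / 2\<close>, so that after division by \<open>\<rho>\<close> the
  derivatives of energy, free energy and entropy are \<open>- n d / 4 < 0\<close>, \<open>d / 2 > 0\<close> and
  \<open>(2 - n) d / 4\<close>. The last one is negative exactly when \<open>n > 2\<close>.
  The derivatives are obtained from pointwise expansions with an integrable quadratic remainder
  (\<open>has_real_derivative_integral_quadratic_remainder\<close>).
\<close>

section \<open>Derivatives of parameter integrals\<close>

text \<open>If \<open>f u = f 0 + u f' + O(u\<^sup>2)\<close> pointwise with an integrable constant in the remainder, then the
  integral of \<open>f u\<close> is differentiable at \<open>0\<close> and its derivative is the integral of \<open>f'\<close>.\<close>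
lemma has_real_derivative_integral_quadratic_remainder:
  fixes f :: "real \<Rightarrow> 'a \<Rightarrow> real"
  assumes r: "r > 0"
    and f: "\<And>u. \<bar>u\<bar> \<le> r \<Longrightarrow> integrable M (f u)"
    and f': "integrable M f'" and w: "integrable M w"
    and rem: "\<And>u x. \<bar>u\<bar> \<le> r \<Longrightarrow> \<bar>f u x - f 0 x - u * f' x\<bar> \<le> u\<^sup>2 * w x"
  shows "((\<lambda>u. LINT x|M. f u x) has_real_derivative (LINT x|M. f' x)) (at 0)"
proof -
  define F where "F u = (LINT x|M. f u x)" for u
  define D where "D = (LINT x|M. f' x)"
  define W where "W = (LINT x|M. w x)"
  have F_bound: "\<bar>F u - F 0 - u * D\<bar> \<le> u\<^sup>2 * W" if u: "\<bar>u\<bar> \<le> r" for u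
  proof -
    have f0: "integrable M (f 0)" using f[of 0] r by simp
    note [simp] = f[OF u] f0 f' w
    have "F u - F 0 - u * D = (LINT x|M. f u x - f 0 x - u * f' x)"
      by (simp add: F_def D_def)
    also have "\<bar>\<dots>\<bar> \<le> (LINT x|M. u\<^sup>2 * w x)"
      by (intro order_trans[OF integral_abs_bound] integral_mono)
        (simp_all add: rem[OF u] Bochner_Integration.integrable_diff)
    also have "\<dots> = u\<^sup>2 * W" by (simp add: W_def)
    finally show ?thesis .
  qed
  have "((\<lambda>h. (F (0 + h) - F 0) / h - D) \<longlongrightarrow> 0) (at 0)"
  proof (rule Lim_null_comparison)
    have "\<bar>(F h - F 0) / h - D\<bar> \<le> \<bar>h\<bar> * W" if "h \<noteq> 0" "\<bar>h\<bar> < r" for h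
    proof -
      have "(F h - F 0) / h - D = (F h - F 0 - h * D) / h" using that by (simp add: field_simps)
      then have "\<bar>(F h - F 0) / h - D\<bar> = \<bar>F h - F 0 - h * D\<bar> / \<bar>h\<bar>" by simp
      also have "\<dots> \<le> h\<^sup>2 * W / \<bar>h\<bar>"
        using F_bound[of h] that by (intro divide_right_mono) auto
      also have "\<dots> = \<bar>h\<bar> * W"
        using that by (simp add: power2_eq_square field_simps flip: abs_mult)
      finally show ?thesis .
    qed
    then show "\<forall>\<^sub>F h in at 0. norm ((F (0 + h) - F 0) / h - D) \<le> \<bar>h\<bar> * W"
      using r by (auto simp: eventually_at dist_real_def intro!: exI[of _ r])
    show "((\<lambda>h. \<bar>h\<bar> * W) \<longlongrightarrow> 0) (at (0::real))"
      by (auto intro!: tendsto_eq_intros)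
  qed
  then have "(F has_real_derivative D) (at 0)"
    unfolding DERIV_def using Lim_null by blast
  then show ?thesis unfolding F_def D_def .
qed

section \<open>Gaussian integrals\<close>

lemma integral_lborel_scaleR:
  fixes f :: "'a::euclidean_space \<Rightarrow> real"
  assumes "c > 0" and [measurable]: "f \<in> borel_measurable borel"
  shows "(LINT v|lborel. f (c *\<^sub>R v)) = (LINT v|lborel. f v) / c ^ DIM('a)"
proof -
  have "(LINT v|lborel. f v) = (LINT v|density (distr lborel borel (\<lambda>x. 0 + c *\<^sub>R x)) (\<lambda>_. \<bar>c\<bar>^DIM('a)). f v)"
    using assms by (subst lborel_affine[of c 0]) auto
  also have "\<dots> = c ^ DIM('a) * (LINT v|lborel. f (c *\<^sub>R v))"
    using assms by (subst integral_density) (auto simp: integral_distr)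
  finally show ?thesis using assms by (simp add: field_simps)
qed

lemma integrable_lborel_scaleR:
  fixes f :: "'a::euclidean_space \<Rightarrow> real"
  assumes "c > 0" and f: "integrable lborel f"
  shows "integrable lborel (\<lambda>v. f (c *\<^sub>R v))"
proof -
  have [measurable]: "f \<in> borel_measurable borel" using f by auto
  have "integrable (density (distr lborel borel (\<lambda>x. 0 + c *\<^sub>R x)) (\<lambda>_. \<bar>c\<bar>^DIM('a))) f"
    using assms lborel_affine[of c "0::'a"] by simp
  then show ?thesis
    using assms by (subst (asm) integrable_density) (auto simp: integrable_distr_eq)
qed

lemma integrable_exp_norm_square:
  fixes c :: real
  assumes "c > 0"
  shows "integrable lborel (\<lambda>v::'a::euclidean_space. exp (- (c * (norm v)\<^sup>2)))"
proof (rule integrableI_nonneg)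
  define \<sigma> where "\<sigma> = 1 / sqrt (2 * c)"
  have 1: "integrable lborel (\<lambda>x::real. exp (- (c * x\<^sup>2)))"
  proof -
    have "exp (- (c * x\<^sup>2)) = sqrt (2 * pi * \<sigma>\<^sup>2) * normal_density 0 \<sigma> x" for x
      using assms by (simp add: normal_density_def \<sigma>_def power_divide field_simps)
    moreover have "\<sigma> > 0" using assms by (simp add: \<sigma>_def)
    ultimately show ?thesis by (simp add: integrable_normal_density)
  qed
  have "exp (- (c * (norm v)\<^sup>2)) = (\<Prod>b\<in>Basis. exp (- (c * (v \<bullet> b)\<^sup>2)))" for v :: 'a
  proof -
    have "(norm v)\<^sup>2 = (\<Sum>b\<in>Basis. (v \<bullet> b)\<^sup>2)"
      by (subst power2_norm_eq_inner, subst euclidean_inner) (simp add: power2_eq_square)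
    then show ?thesis
      by (simp add: sum_distrib_left exp_sum flip: sum_negf)
  qed
  then have "(\<integral>\<^sup>+ v. ennreal (exp (- (c * (norm (v::'a))\<^sup>2))) \<partial>lborel) =
     (\<integral>\<^sup>+ v. (\<Prod>b\<in>Basis. ennreal (exp (- (c * ((v::'a) \<bullet> b)\<^sup>2)))) \<partial>lborel)"
    by (simp add: prod_ennreal)
  also have "\<dots> = (\<Prod>b\<in>(Basis::'a set). (\<integral>\<^sup>+ x. ennreal (exp (- (c * x\<^sup>2))) \<partial>lborel))"
    by (rule nn_integral_lborel_prod) auto
  also have "\<dots> < \<infinity>"
    using 1 by (simp add: integrable_iff_bounded power_less_top_ennreal)
  finally show "(\<integral>\<^sup>+ v. ennreal (exp (- (c * (norm (v::'a))\<^sup>2))) \<partial>lborel) < \<infinity>" .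
qed auto

text \<open>The unnormalised Gaussian (its total mass is not \<open>1\<close>).\<close>
definition gauss :: "'a::euclidean_space \<Rightarrow> real" where
  "gauss v = exp (- (norm v)\<^sup>2 / 2)"

lemma gauss_pos [simp]: "0 < gauss v" and gauss_le_1 [simp]: "gauss v \<le> 1"
  by (auto simp: gauss_def)

lemma gauss_nonneg [simp]: "0 \<le> gauss v" using gauss_pos[of v] by linarith

lemma borel_measurable_gauss [measurable]: "gauss \<in> borel_measurable borel"
  unfolding gauss_def[abs_def] by measurable

lemma integrable_gauss [simp]: "integrable lborel (gauss :: 'a::euclidean_space \<Rightarrow> real)"
  using integrable_exp_norm_square[of "1/2", where 'a='a] by (simp add: gauss_def[abs_def])

lemma power2_le_2_exp: "(x::real)\<^sup>2 \<le> 2 * exp x" if "x \<ge> 0"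
  using exp_lower_Taylor_quadratic[OF that] that by simp

lemma integrable_energy_gauss [simp]:
  "integrable lborel (\<lambda>v::'a::euclidean_space. (norm v)\<^sup>2 / 2 * gauss v)"
proof (rule Bochner_Integration.integrable_bound)
  show "integrable lborel (\<lambda>v::'a. 2 * exp (- (1 / 4 * (norm v)\<^sup>2)))"
    using integrable_exp_norm_square[of "1/4", where 'a='a] by simp
  have "(norm v)\<^sup>2 / 2 * gauss v \<le> 2 * exp (- (1 / 4 * (norm v)\<^sup>2))" for v :: 'a
  proof -
    have "(norm v)\<^sup>2 / 4 \<le> exp ((norm v)\<^sup>2 / 4)"
      using exp_ge_add_one_self[of "(norm v)\<^sup>2 / 4"] by linarith
    then have "(norm v)\<^sup>2 / 4 * exp (- (norm v)\<^sup>2 / 2) \<le> exp ((norm v)\<^sup>2 / 4) * exp (- (norm v)\<^sup>2 / 2)"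
      by (intro mult_right_mono) auto
    also have "\<dots> = exp (- (1 / 4 * (norm v)\<^sup>2))" by (simp flip: exp_add)
    finally show ?thesis by (simp add: gauss_def)
  qed
  then show "AE v in lborel. norm ((norm v)\<^sup>2 / 2 * gauss v) \<le> norm (2 * exp (- (1 / 4 * (norm (v::'a))\<^sup>2)))"
    by (simp add: abs_mult)
qed measurable

lemma gauss_scaleR: "gauss (c *\<^sub>R v) = exp (- (c\<^sup>2 * ((norm v)\<^sup>2 / 2)))"
  by (simp add: gauss_def power_mult_distrib)

lemma gauss_square: "(gauss v)\<^sup>2 = gauss (sqrt 2 *\<^sub>R v)"
  by (simp add: gauss_scaleR) (simp add: gauss_def flip: exp_double)

lemma integral_lborel_strict_mono:
  fixes f g :: "'a::euclidean_space \<Rightarrow> real"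
  assumes "integrable lborel f" "integrable lborel g" "\<And>x. f x < g x"
  shows "(LINT x|lborel. f x) < (LINT x|lborel. g x)"
proof -
  have int: "integrable lborel (\<lambda>x. g x - f x)" using assms by simp
  have "(LINT x|lborel. g x - f x) \<noteq> 0"
  proof
    assume "(LINT x|lborel. g x - f x) = 0"
    then have "AE x in lborel. g x - f x = 0"
      using integral_nonneg_eq_0_iff_AE[OF int] assms(3) by (simp add: less_imp_le)
    then have "AE x in (lborel :: 'a measure). False"
      by (rule eventually_mono) (metis assms(3) diff_gt_0_iff_gt less_irrefl)
    then show False by (simp add: AE_iff_null null_sets_def)
  qed
  moreover have "(LINT x|lborel. g x - f x) \<ge> 0"
    using assms(3) by (intro integral_nonneg_AE) (simp add: less_imp_le)
  ultimately show ?thesis using assms by simp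
qed

lemma integral_gauss_pos: "0 < (LINT v|lborel. gauss (v::'a::euclidean_space))"
proof -
  have "(LINT v|(lborel :: 'a measure). 0) < (LINT v|(lborel :: 'a measure). gauss v)"
    by (rule integral_lborel_strict_mono) auto
  then show ?thesis by simp
qed

text \<open>The second moment comes from differentiating, at \<open>h = 0\<close>, the scaling identity
  \<open>\<integral> exp (- (1 + h) |v|\<^sup>2 / 2) dv = (1 + h) powr (- n / 2) * \<integral> exp (- |v|\<^sup>2 / 2) dv\<close>.
  The value of the Gaussian integral itself is never needed.\<close>
lemma integral_energy_gauss:
  "(LINT v|lborel. (norm v)\<^sup>2 / 2 * gauss (v::'a::euclidean_space)) =
     real DIM('a) / 2 * (LINT v|lborel. gauss (v::'a))"
proof -
  define a where "a = (LINT v|lborel. gauss (v::'a))"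
  define f where "f h v = exp (- ((1 + h) * ((norm v)\<^sup>2 / 2)))" for h and v :: 'a
  have f_eq: "f h v = gauss (sqrt (1 + h) *\<^sub>R v)" if "\<bar>h\<bar> \<le> 1 / 2" for h v
    using that by (simp add: f_def gauss_scaleR)
  have "((\<lambda>h. LINT v|lborel. f h v) has_real_derivative
      (LINT v|lborel. - ((norm v)\<^sup>2 / 2 * gauss (v::'a)))) (at 0)"
  proof (rule has_real_derivative_integral_quadratic_remainder)
    show "0 < (1/2::real)" by simp
    show "integrable lborel (f h)" if "\<bar>h\<bar> \<le> 1 / 2" for h
    proof -
      have "f h = (\<lambda>v. gauss (sqrt (1 + h) *\<^sub>R v))" using f_eq that by blast
      moreover have "integrable lborel (\<lambda>v::'a. gauss (sqrt (1 + h) *\<^sub>R v))"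
        using that by (intro integrable_lborel_scaleR) auto
      ultimately show ?thesis by metis
    qed
    show "integrable lborel (\<lambda>v::'a. - ((norm v)\<^sup>2 / 2 * gauss v))"
      using integrable_energy_gauss by (rule Bochner_Integration.integrable_minus)
    show "integrable lborel (\<lambda>v::'a. 16 * exp (- (1 / 8 * (norm v)\<^sup>2)))"
      using integrable_exp_norm_square[of "1/8", where 'a='a] by simp
    show "\<bar>f h v - f 0 v - h * - ((norm v)\<^sup>2 / 2 * gauss v)\<bar> \<le> h\<^sup>2 * (16 * exp (- (1 / 8 * (norm v)\<^sup>2)))"
      if h: "\<bar>h\<bar> \<le> 1 / 2" for h and v :: 'a
    proof -
      define s where "s = (norm v)\<^sup>2 / 2"
      have s: "s \<ge> 0" by (simp add: s_def)
      \<comment> \<open>For \<open>|h| \<le> 1/2\<close> the Taylor remainder is at most \<open>h\<^sup>2 s\<^sup>2 exp (- s / 2) / 2\<close>;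
        half of the remaining exponential decay absorbs the factor \<open>s\<^sup>2\<close>.\<close>
      obtain t where t: "\<bar>t\<bar> \<le> \<bar>- (h * s)\<bar>"
        "exp (- (h * s)) = (\<Sum>m<2. (- (h * s)) ^ m / fact m) + exp t / fact 2 * (- (h * s))\<^sup>2"
        using Maclaurin_exp_le[of "- (h * s)" 2] by blast
      have "\<bar>h * s\<bar> \<le> s / 2"
        using mult_right_mono[OF h s] s by (simp add: abs_mult)
      then have ts: "t \<le> s / 2" using t(1) by linarith
      have "f h v - f 0 v - h * - ((norm v)\<^sup>2 / 2 * gauss v)
          = exp (- s) * (exp (- (h * s)) - 1 + h * s)"
        by (simp add: f_def gauss_def s_def algebra_simps flip: exp_add)
      also have "\<dots> = exp (- s) * (exp t / 2 * (h * s)\<^sup>2)"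
        using t(2) by (simp add: numeral_2_eq_2)
      finally have "\<bar>f h v - f 0 v - h * - ((norm v)\<^sup>2 / 2 * gauss v)\<bar>
          = \<bar>exp (- s) * (exp t / 2 * (h * s)\<^sup>2)\<bar>"
        by (rule arg_cong)
      also have "\<dots> = h\<^sup>2 * (s\<^sup>2 / 2 * (exp (- s) * exp t))"
        by (simp add: abs_mult power_mult_distrib)
      also have "h\<^sup>2 * (s\<^sup>2 / 2 * (exp (- s) * exp t)) \<le> h\<^sup>2 * (16 * exp (s / 4) * exp (- s / 2))"
      proof (intro mult_left_mono mult_mono)
        show "exp (- s) * exp t \<le> exp (- s / 2)" using ts by (simp flip: exp_add)
        show "s\<^sup>2 / 2 \<le> 16 * exp (s / 4)"
          using power2_le_2_exp[of "s / 4"] s by (simp add: power_divide)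
      qed auto
      also have "16 * exp (s / 4) * exp (- s / 2) = 16 * exp (- (1 / 8 * (norm v)\<^sup>2))"
        by (simp add: s_def flip: exp_add)
      finally show ?thesis .
    qed
  qed
  moreover have "((\<lambda>h. LINT v|lborel. f h v) has_real_derivative - (real DIM('a) / 2 * a)) (at 0)"
  proof (rule has_field_derivative_transform_within)
    have "((\<lambda>h. a / sqrt (1 + h) ^ DIM('a)) has_real_derivative
        - (a * (real DIM('a) * (inverse (sqrt (1 + 0)) / 2))) ) (at 0)"
      by (rule derivative_eq_intros refl | simp)+
    then show "((\<lambda>h. a / sqrt (1 + h) ^ DIM('a)) has_real_derivative
        - (real DIM('a) / 2 * a)) (at 0)" by (simp add: mult_ac)
    show "a / sqrt (1 + h) ^ DIM('a) = (LINT v|lborel. f h v)" if "h \<in> UNIV" "dist h 0 < 1 / 2" for h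
      using that f_eq[of h] integral_lborel_scaleR[of "sqrt (1 + h)" "gauss :: 'a \<Rightarrow> real"]
      by (simp add: dist_real_def a_def)
  qed auto
  ultimately have "(LINT v|lborel. - ((norm v)\<^sup>2 / 2 * gauss (v::'a))) = - (real DIM('a) / 2 * a)"
    by (rule DERIV_unique)
  then show ?thesis by (simp add: a_def)
qed

section \<open>Bose integrals and their logarithmic companion\<close>

text \<open>The integral of the weight \<open>w\<close> against the equilibrium profile with unit prefactor, as a function
  of \<open>u = k * C\<close>. Both quantum statistics are covered: \<open>u > 0\<close> for bosons, \<open>u < 0\<close> for fermions.
  The weights \<open>1\<close> and \<open>|v|\<^sup>2 / 2\<close> give mass and energy.\<close>
definition bose_integral :: "('a::euclidean_space \<Rightarrow> real) \<Rightarrow> real \<Rightarrow> real" where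
  "bose_integral w u = (LINT v|lborel. w v * (gauss v / (1 - u * gauss v)))"

text \<open>The function \<open>- ln (1 - u x) / u\<close>, which enters the entropy, extended continuously to \<open>u = 0\<close>;
  the extension makes the classical and the quantum formulas coincide.\<close>
definition bose_log :: "real \<Rightarrow> real \<Rightarrow> real" where
  "bose_log u x = (if u = 0 then x else - ln (1 - u * x) / u)"

lemma one_minus_mult_lower_bound:
  fixes u x :: real
  assumes "0 < x" "x \<le> 1"
  shows "min 1 (1 - u) \<le> 1 - u * x"
proof (cases "u \<le> 0")
  case True
  then show ?thesis using assms by (simp add: mult_nonpos_nonneg)
next
  case False
  then show ?thesis using assms mult_left_le[of x u] by auto
qed

lemma one_minus_mult_pos:
  fixes u x :: real
  assumes "u < 1" "0 < x" "x \<le> 1"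
  shows "0 < 1 - u * x"
  using one_minus_mult_lower_bound[of x u] assms by linarith

lemma integrable_bose:
  fixes w :: "'a::euclidean_space \<Rightarrow> real"
  assumes u: "u < 1" and [measurable]: "w \<in> borel_measurable borel"
    and w: "integrable lborel (\<lambda>v. w v * gauss v)"
  shows "integrable lborel (\<lambda>v. w v * (gauss v / (1 - u * gauss v)))"
proof (rule Bochner_Integration.integrable_bound)
  define m where "m = min 1 (1 - u)"
  have m: "0 < m" using u by (simp add: m_def)
  show "integrable lborel (\<lambda>v. w v * gauss v / m)" using w by simp
  have "\<bar>w v * gauss v\<bar> / \<bar>1 - u * gauss v\<bar> \<le> \<bar>w v * gauss v\<bar> / m" for v
    using m one_minus_mult_lower_bound[of "gauss v" u] unfolding m_def[symmetric]
    by (intro divide_left_mono mult_pos_pos) auto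
  then show "AE v in lborel. norm (w v * (gauss v / (1 - u * gauss v))) \<le> norm (w v * gauss v / m)"
    using m by (simp add: abs_mult)
qed measurable

lemma has_real_derivative_bose_integral:
  fixes w :: "'a::euclidean_space \<Rightarrow> real"
  assumes [measurable]: "w \<in> borel_measurable borel"
    and w: "integrable lborel (\<lambda>v. w v * gauss v)"
  shows "(bose_integral w has_real_derivative (LINT v|lborel. w v * (gauss v)\<^sup>2)) (at 0)"
proof -
  have "((\<lambda>u. LINT v|lborel. w v * (gauss v / (1 - u * gauss v))) has_real_derivative
      (LINT v|lborel. w v * (gauss v)\<^sup>2)) (at 0)"
  proof (rule has_real_derivative_integral_quadratic_remainder)
    show "0 < (1 / 2 :: real)" by simp
    show "integrable lborel (\<lambda>v. w v * (gauss v / (1 - u * gauss v)))" if "\<bar>u\<bar> \<le> 1 / 2" for u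
      using that w by (intro integrable_bose) auto
    have "\<bar>w v\<bar> * (gauss v)\<^sup>2 \<le> \<bar>w v\<bar> * gauss v" for v
      by (intro mult_left_mono) (auto simp: power2_eq_square mult_left_le)
    with w show "integrable lborel (\<lambda>v. w v * (gauss v)\<^sup>2)"
      by (intro Bochner_Integration.integrable_bound[OF w]) (auto simp: abs_mult)
    show "integrable lborel (\<lambda>v. 2 * \<bar>w v * gauss v\<bar>)" using w by simp
    show "\<bar>w v * (gauss v / (1 - u * gauss v)) - w v * (gauss v / (1 - 0 * gauss v))
         - u * (w v * (gauss v)\<^sup>2)\<bar> \<le> u\<^sup>2 * (2 * \<bar>w v * gauss v\<bar>)" if u: "\<bar>u\<bar> \<le> 1 / 2" for u v
    proof -
      define x where "x = gauss v"
      have x: "0 < x" "x \<le> 1" by (auto simp: x_def)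
      have d: "1 / 2 \<le> 1 - u * x" using one_minus_mult_lower_bound[OF x, of u] u by linarith
      have "x\<^sup>2 / (1 - u * x) \<le> 1 / (1 / 2)"
        using x d by (intro frac_le) (auto simp: power_le_one)
      then have q: "x\<^sup>2 / (1 - u * x) \<le> 2" by simp
      have "w v * (x / (1 - u * x)) - w v * (x / (1 - 0 * x)) - u * (w v * x\<^sup>2)
          = u\<^sup>2 * (x\<^sup>2 / (1 - u * x) * (w v * x))"
        using d by (simp add: field_simps power2_eq_square)
      moreover have "\<bar>u\<^sup>2 * (x\<^sup>2 / (1 - u * x) * (w v * x))\<bar>
          = u\<^sup>2 * (x\<^sup>2 / (1 - u * x) * \<bar>w v * x\<bar>)"
        using d by (simp add: abs_mult)
      moreover have "\<dots> \<le> u\<^sup>2 * (2 * \<bar>w v * x\<bar>)"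
        using q by (intro mult_left_mono mult_right_mono) auto
      ultimately show ?thesis unfolding x_def by simp
    qed
  qed
  then show ?thesis by (simp add: bose_integral_def[abs_def])
qed

lemma ln_one_minus_cubic_remainder:
  fixes y :: real
  assumes y: "\<bar>y\<bar> \<le> 1 / 2"
  shows "\<bar>- ln (1 - y) - y - y\<^sup>2 / 2\<bar> \<le> 2 * \<bar>y\<bar> ^ 3"
proof -
  define S where "S = {- \<bar>y\<bar>..\<bar>y\<bar>}"
  have "norm ((- ln (1 - y) - y - y\<^sup>2 / 2) - (- ln (1 - 0) - 0 - 0\<^sup>2 / 2)) \<le> 2 * y\<^sup>2 * norm (y - 0)"
  proof (rule field_differentiable_bound)
    show "convex S" by (simp add: S_def)
    show "((\<lambda>t. - ln (1 - t) - t - t\<^sup>2 / 2) has_real_derivative t\<^sup>2 / (1 - t)) (at t within S)"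
      if "t \<in> S" for t
    proof -
      have "t \<le> 1 / 2" using that y by (auto simp: S_def)
      then show ?thesis
        by (auto intro!: derivative_eq_intros simp: field_simps power2_eq_square)
    qed
    show "norm (t\<^sup>2 / (1 - t)) \<le> 2 * y\<^sup>2" if "t \<in> S" for t
    proof -
      have t: "\<bar>t\<bar> \<le> \<bar>y\<bar>" using that by (auto simp: S_def)
      have t': "1 / 2 \<le> 1 - t" using t y by linarith
      have "t\<^sup>2 / (1 - t) \<le> y\<^sup>2 / (1 / 2)"
        using t t' by (intro frac_le) (auto simp: abs_le_square_iff)
      then show ?thesis using t' by simp
    qed
    show "y \<in> S" "0 \<in> S" by (auto simp: S_def)
  qed
  then show ?thesis by (simp add: power2_eq_square power3_eq_cube)
qed

lemma bose_log_quadratic_remainder: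
  assumes u: "\<bar>u\<bar> \<le> 1 / 2" and x: "0 < x" "x \<le> 1"
  shows "\<bar>bose_log u x - x - u * (x\<^sup>2 / 2)\<bar> \<le> u\<^sup>2 * (2 * x)"
proof (cases "u = 0")
  case True
  then show ?thesis by (simp add: bose_log_def)
next
  case False
  have "\<bar>u * x\<bar> \<le> 1 / 2 * 1" unfolding abs_mult using u x by (intro mult_mono) auto
  then have "\<bar>- ln (1 - u * x) - u * x - (u * x)\<^sup>2 / 2\<bar> \<le> 2 * \<bar>u * x\<bar> ^ 3"
    by (intro ln_one_minus_cubic_remainder) simp
  moreover have "bose_log u x - x - u * (x\<^sup>2 / 2) = (- ln (1 - u * x) - u * x - (u * x)\<^sup>2 / 2) / u"
    using False by (simp add: bose_log_def field_simps power2_eq_square)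
  ultimately have "\<bar>bose_log u x - x - u * (x\<^sup>2 / 2)\<bar> \<le> 2 * \<bar>u * x\<bar> ^ 3 / \<bar>u\<bar>"
    by (simp add: divide_right_mono)
  also have "\<dots> = u\<^sup>2 * (2 * x ^ 3)"
    using False x by (simp add: abs_mult power2_eq_square power3_eq_cube)
  also have "\<dots> \<le> u\<^sup>2 * (2 * x)"
    using x power_decreasing[of 1 3 x] by (intro mult_left_mono) auto
  finally show ?thesis .
qed

lemma borel_measurable_bose_log [measurable]: "bose_log u \<in> borel_measurable borel"
  unfolding bose_log_def[abs_def] by measurable

lemma integrable_bose_log:
  assumes u: "\<bar>u\<bar> \<le> 1 / 2"
  shows "integrable lborel (\<lambda>v::'a::euclidean_space. bose_log u (gauss v))"
proof (rule Bochner_Integration.integrable_bound)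
  show "integrable lborel (\<lambda>v::'a. 2 * gauss v)" by simp
  have "\<bar>bose_log u x\<bar> \<le> 2 * x" if x: "0 < x" "x \<le> 1" for x
  proof -
    have "u\<^sup>2 \<le> (1 / 2)\<^sup>2" using u by (subst abs_le_square_iff[symmetric]) simp
    then have "u\<^sup>2 * (2 * x) \<le> 1 / 4 * (2 * x)"
      using x by (intro mult_right_mono) (auto simp: power2_eq_square)
    moreover have "\<bar>u * (x\<^sup>2 / 2)\<bar> \<le> 1 / 2 * (x / 2)"
      unfolding abs_mult using u x by (intro mult_mono) (auto simp: power2_eq_square mult_left_le)
    ultimately show ?thesis
      using bose_log_quadratic_remainder[OF u x] x by linarith
  qed
  then show "AE v in lborel. norm (bose_log u (gauss (v::'a))) \<le> norm (2 * gauss v)"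
    by simp
qed measurable

lemma integrable_gauss_square: "integrable lborel (\<lambda>v::'a::euclidean_space. (gauss v)\<^sup>2)"
  by (rule Bochner_Integration.integrable_bound[OF integrable_gauss])
    (auto simp: power2_eq_square mult_left_le)

lemma has_real_derivative_integral_bose_log:
  "((\<lambda>u. LINT v|lborel. bose_log u (gauss (v::'a::euclidean_space))) has_real_derivative
     (LINT v|lborel. (gauss (v::'a))\<^sup>2) / 2) (at 0)"
proof -
  have "((\<lambda>u. LINT v|lborel. bose_log u (gauss (v::'a))) has_real_derivative
     (LINT v|lborel. (gauss (v::'a))\<^sup>2 / 2)) (at 0)"
    by (rule has_real_derivative_integral_quadratic_remainder[where r = "1 / 2" and w = "\<lambda>v. 2 * gauss v"])
      (use bose_log_quadratic_remainder integrable_gauss_square in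
        \<open>auto simp: integrable_bose_log bose_log_def[of 0]\<close>)
  then show ?thesis by simp
qed

text \<open>Squaring the Gaussian is the dilation by \<open>sqrt 2\<close>, so the first-order coefficients below
  are the integrals at \<open>u = 0\<close> times \<open>2 powr (- n / 2)\<close>, with a further factor \<open>1/2\<close> for the energy weight.\<close>
lemma integral_gauss_square:
  "(LINT v|lborel. (gauss (v::'a::euclidean_space))\<^sup>2) = (LINT v|lborel. gauss (v::'a)) / sqrt 2 ^ DIM('a)"
  by (simp add: gauss_square integral_lborel_scaleR)

lemma integral_energy_gauss_square:
  "(LINT v|lborel. (norm v)\<^sup>2 / 2 * (gauss (v::'a::euclidean_space))\<^sup>2) =
     (LINT v|lborel. (norm v)\<^sup>2 / 2 * gauss (v::'a)) / sqrt 2 ^ DIM('a) / 2"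
proof -
  define f where "f v = (norm v)\<^sup>2 / 2 * gauss v" for v :: 'a
  have [measurable]: "f \<in> borel_measurable borel" unfolding f_def by measurable
  have "(norm v)\<^sup>2 / 2 * (gauss v)\<^sup>2 = f (sqrt 2 *\<^sub>R v) / 2" for v
    by (simp add: f_def gauss_square power_mult_distrib)
  then have "(LINT v|lborel. (norm v)\<^sup>2 / 2 * (gauss (v::'a))\<^sup>2) = (LINT v|lborel. f v) / sqrt 2 ^ DIM('a) / 2"
    by (simp only:) (simp add: integral_lborel_scaleR)
  then show ?thesis unfolding f_def .
qed

text \<open>Supplies the continuity needed to solve the mass equation by the intermediate value theorem.\<close>
lemma bose_integral_lipschitz:
  assumes u: "\<bar>u\<bar> \<le> 1 / 2" and u': "\<bar>u'\<bar> \<le> 1 / 2"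
  shows "\<bar>bose_integral (\<lambda>_::'a::euclidean_space. 1) u - bose_integral (\<lambda>_::'a. 1) u'\<bar>
     \<le> 4 * (LINT v|lborel. gauss (v::'a)) * \<bar>u - u'\<bar>"
proof -
  have int: "integrable lborel (\<lambda>v::'a. gauss v / (1 - t * gauss v))" if "\<bar>t\<bar> \<le> 1 / 2" for t
    using integrable_bose[of t "\<lambda>_::'a. 1"] that by simp
  have *: "\<bar>gauss v / (1 - u * gauss v) - gauss v / (1 - u' * gauss v)\<bar> \<le> 4 * gauss v * \<bar>u - u'\<bar>"
    for v :: 'a
  proof -
    define x where "x = gauss v"
    have x: "0 < x" "x \<le> 1" by (auto simp: x_def)
    have d: "1 / 2 \<le> 1 - u * x" "1 / 2 \<le> 1 - u' * x"
      using one_minus_mult_lower_bound[OF x, of u] one_minus_mult_lower_bound[OF x, of u'] u u'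
      by linarith+
    have "x / (1 - u * x) - x / (1 - u' * x) = x * x * (u - u') / ((1 - u * x) * (1 - u' * x))"
      using d by (simp add: field_simps)
    then have "\<bar>x / (1 - u * x) - x / (1 - u' * x)\<bar> = x * x * \<bar>u - u'\<bar> / ((1 - u * x) * (1 - u' * x))"
      using d x by (simp add: abs_mult)
    also have "\<dots> \<le> (x * 1 * \<bar>u - u'\<bar>) / (1 / 2 * (1 / 2))"
      using d x by (intro frac_le mult_mono) auto
    finally show ?thesis by (simp add: x_def)
  qed
  have "bose_integral (\<lambda>_::'a. 1) u - bose_integral (\<lambda>_::'a. 1) u' =
     (LINT v|lborel. gauss (v::'a) / (1 - u * gauss v) - gauss v / (1 - u' * gauss v))"
    using int[OF u] int[OF u'] by (simp add: bose_integral_def)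
  also have "\<bar>\<dots>\<bar> \<le> (LINT v|lborel. 4 * gauss (v::'a) * \<bar>u - u'\<bar>)"
    using int[OF u] int[OF u'] *
    by (intro order_trans[OF integral_abs_bound] integral_mono) auto
  finally show ?thesis by simp
qed

section \<open>Equilibria and the mass constant\<close>

lemma maxwellian_eq:
  "maxwellian k C v = C * (gauss v / (1 - k * C * gauss v))"
  by (simp add: maxwellian_def gauss_def)

lemma integral_maxwellian:
  "(LINT v|lborel. maxwellian k C (v::real^'n)) = C * bose_integral (\<lambda>_::real^'n. 1) (k * C)"
  by (simp add: maxwellian_eq bose_integral_def del: times_divide_eq_right)

lemma integrable_maxwellian:
  assumes "k * C < 1"
  shows "integrable lborel (maxwellian k C :: real^'n \<Rightarrow> real)"
  unfolding maxwellian_eq[abs_def] using integrable_bose[OF assms, of "\<lambda>_::real^'n. 1"]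
  by (intro integrable_mult_right) simp

lemma maxwellian_strict_mono:
  assumes "0 < C" "C < C'" "k * C < 1" "k * C' < 1"
  shows "maxwellian k C v < maxwellian k C' v"
proof -
  define x where "x = gauss v"
  have x: "0 < x" "x \<le> 1" by (auto simp: x_def)
  have d: "0 < 1 - k * C * x" "0 < 1 - k * C' * x"
    using one_minus_mult_pos[OF assms(3) x] one_minus_mult_pos[OF assms(4) x] by auto
  have "C * x * (1 - k * C' * x) < C' * x * (1 - k * C * x)"
    using assms x by (simp add: algebra_simps)
  then have "C * x / (1 - k * C * x) < C' * x / (1 - k * C' * x)"
    using d by (simp add: divide_simps mult.commute)
  then show ?thesis by (simp add: maxwellian_eq x_def)
qed

text \<open>A solution of the mass equation is the only one, since the profile increases strictly with
  \<open>C\<close> at every velocity.\<close>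
lemma mass_const_eqI:
  fixes \<Omega> :: "(real^'n) set"
  assumes V: "0 < measure lborel \<Omega>" and C: "0 < C" "k * C < 1"
    and mass: "measure lborel \<Omega> * (LINT v|lborel. maxwellian k C (v::real^'n)) = \<rho>"
  shows "mass_const \<Omega> \<rho> k = C"
  unfolding mass_const_def
proof (rule the_equality)
  show "0 < C \<and> k * C < 1 \<and>
    measure lborel \<Omega> * (LINT v|(lborel :: (real^'n) measure). maxwellian k C v) = \<rho>"
    using assms by simp
next
  fix C'
  assume C': "0 < C' \<and> k * C' < 1 \<and>
    measure lborel \<Omega> * (LINT v|(lborel :: (real^'n) measure). maxwellian k C' v) = \<rho>"
  have less: "(LINT v|lborel. maxwellian k A (v::real^'n)) < (LINT v|lborel. maxwellian k B (v::real^'n))"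
    if "0 < A" "A < B" "k * A < 1" "k * B < 1" for A B
    using that by (intro integral_lborel_strict_mono integrable_maxwellian maxwellian_strict_mono)
  have "(LINT v|lborel. maxwellian k C' (v::real^'n)) = (LINT v|lborel. maxwellian k C (v::real^'n))"
    using C' mass V by (metis mult_cancel_left less_irrefl)
  then show "C' = C"
    using less[of C C'] less[of C' C] C C' by (cases C C' rule: linorder_cases) auto
qed

lemma energy_equilibrium:
  fixes \<Omega> :: "(real^'n) set"
  assumes "\<Omega> \<in> sets lborel" "emeasure lborel \<Omega> \<noteq> \<infinity>" and "mass_const \<Omega> \<rho> k = C"
  shows "energy \<Omega> (equilibrium \<Omega> \<rho> k) =
     measure lborel \<Omega> * (C * bose_integral (\<lambda>v::real^'n. (norm v)\<^sup>2 / 2) (k * C))"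
proof -
  have "(norm v)\<^sup>2 / 2 * maxwellian k C v
      = C * ((norm v)\<^sup>2 / 2 * (gauss v / (1 - k * C * gauss v)))" for v :: "real^'n"
    by (simp add: maxwellian_eq)
  then have "(LINT v|lborel. (norm v)\<^sup>2 / 2 * maxwellian k C (v::real^'n)) =
      C * bose_integral (\<lambda>v::real^'n. (norm v)\<^sup>2 / 2) (k * C)"
    unfolding bose_integral_def by (simp only: integral_mult_right_zero)
  with assms show ?thesis by (simp add: energy_def equilibrium_def set_integral_const)
qed

text \<open>With \<open>z = C * gauss v\<close> one has \<open>1 + k M = 1 / (1 - k z)\<close> for \<open>M = z / (1 - k z)\<close>, which turns the entropy
  density into \<open>M ln z + M + ln (1 - k z) / k\<close>; the last two terms are replaced by their limit \<open>0\<close>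
  when \<open>k = 0\<close>.\<close>
lemma entropy_density_maxwellian:
  fixes v :: "real^'n"
  assumes C: "0 < C" and u: "k * C < 1"
  defines "q \<equiv> gauss v / (1 - k * C * gauss v)"
  shows "entropy_density k (maxwellian k C v) =
    C * ((ln C + 1) * q - (norm v)\<^sup>2 / 2 * q - bose_log (k * C) (gauss v))"
proof -
  define x where "x = gauss v"
  have x: "0 < x" "x \<le> 1" by (auto simp: x_def)
  have lnx: "ln x = - (norm v)\<^sup>2 / 2" by (simp add: x_def gauss_def)
  have d: "0 < 1 - k * C * x" using one_minus_mult_pos[OF u x] .
  have M: "maxwellian k C v = C * q" by (simp add: maxwellian_eq q_def)
  have q: "q = x / (1 - k * C * x)" by (simp add: q_def x_def)
  show ?thesis
  proof (cases "k = 0")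
    case True
    then have Mx: "maxwellian k C v = C * x" unfolding M q by simp
    have "entropy_density k (maxwellian k C v) = C * x * (ln C + ln x)"
      unfolding entropy_density_def Mx using True C x by (simp add: ln_mult)
    then show ?thesis
      using True by (simp add: q lnx bose_log_def algebra_simps flip: x_def)
  next
    case False
    have one: "1 + k * (C * q) = 1 / (1 - k * C * x)" using d by (simp add: q field_simps)
    have "ln (C * q) = ln C + ln x - ln (1 - k * C * x)"
      using C x d by (simp add: q ln_mult ln_div)
    moreover have "ln (1 + k * (C * q)) = - ln (1 - k * C * x)"
      unfolding one using d by (simp add: ln_div)
    ultimately have "entropy_density k (maxwellian k C v) =
      C * q * (ln C + ln x - ln (1 - k * C * x))
        + (1 + k * (C * q)) / k * ln (1 - k * C * x) + C * q"
      using False by (simp add: entropy_density_def M)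
    also have "\<dots> = C * ((ln C + 1) * q + ln x * q) + ln (1 - k * C * x) / k"
      using False by (simp add: field_simps)
    also have "ln (1 - k * C * x) / k = - C * bose_log (k * C) x"
      using False C by (simp add: bose_log_def)
    finally show ?thesis by (simp add: lnx algebra_simps flip: x_def)
  qed
qed

lemma entropy_equilibrium:
  fixes \<Omega> :: "(real^'n) set"
  assumes \<Omega>: "\<Omega> \<in> sets lborel" "emeasure lborel \<Omega> \<noteq> \<infinity>" and C: "mass_const \<Omega> \<rho> k = C"
    and C0: "0 < C" and u: "\<bar>k * C\<bar> \<le> 1 / 2"
  shows "entropy \<Omega> k (equilibrium \<Omega> \<rho> k) =
     - (measure lborel \<Omega> * (C * ((ln C + 1) * bose_integral (\<lambda>_::real^'n. 1) (k * C)
        - bose_integral (\<lambda>v::real^'n. (norm v)\<^sup>2 / 2) (k * C)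
        - (LINT v|lborel. bose_log (k * C) (gauss (v::real^'n))))))"
proof -
  have u1: "k * C < 1" using u by linarith
  have "integrable lborel (\<lambda>v::real^'n. gauss v / (1 - k * C * gauss v))"
    using integrable_bose[OF u1, of "\<lambda>_::real^'n. 1"] by simp
  moreover have "integrable lborel (\<lambda>v::real^'n. (norm v)\<^sup>2 / 2 * (gauss v / (1 - k * C * gauss v)))"
    by (rule integrable_bose[OF u1 _ integrable_energy_gauss]) measurable
  moreover note integrable_bose_log[OF u, where 'a="real^'n"]
  ultimately have "(LINT v|lborel. entropy_density k (maxwellian k C (v::real^'n))) =
      C * ((ln C + 1) * bose_integral (\<lambda>_::real^'n. 1) (k * C)
        - bose_integral (\<lambda>v::real^'n. (norm v)\<^sup>2 / 2) (k * C)
        - (LINT v|lborel. bose_log (k * C) (gauss (v::real^'n))))"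
    unfolding entropy_density_maxwellian[OF C0 u1] bose_integral_def
    by (simp only: integral_mult_right_zero Bochner_Integration.integral_diff
        Bochner_Integration.integrable_diff integrable_mult_right mult_1)
  with \<Omega> C show ?thesis by (simp add: entropy_def equilibrium_def set_integral_const)
qed

lemma measure_lborel_open_pos:
  fixes S :: "'a::euclidean_space set"
  assumes "open S" "S \<noteq> {}" "emeasure lborel S \<noteq> \<infinity>"
  shows "0 < measure lborel S"
proof -
  obtain x where "x \<in> S" using assms by auto
  then obtain e where e: "e > 0" "ball x e \<subseteq> S" using assms openE by blast
  have "0 < measure lborel (ball x e)"
    using e by (simp add: content_ball_pos)
  also have "\<dots> \<le> measure lborel S"
    using e assms by (intro measure_mono_fmeasurable) (auto simp: fmeasurable_def less_top)
  finally show ?thesis .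
qed

text \<open>For small \<open>k\<close> the mass constant exists and \<open>k * C\<close> is as small as desired. With \<open>C\<^sub>0\<close> the
  classical constant, the intermediate value theorem on \<open>[C\<^sub>0 / 2, 2 C\<^sub>0]\<close> yields a solution, because
  there the mass integral at \<open>k * C\<close> differs from its value at \<open>0\<close> by at most a quarter of the latter.
  No regularity of \<open>C\<close> as a function of \<open>k\<close> is needed.\<close>
lemma mass_const_near_0:
  fixes \<Omega> :: "(real^'n) set"
  assumes V: "0 < measure lborel \<Omega>" and \<rho>: "0 < \<rho>" and \<eta>: "0 < \<eta>"
  obtains \<epsilon> where "0 < \<epsilon>" "\<And>k. \<bar>k\<bar> < \<epsilon> \<Longrightarrow> 0 < mass_const \<Omega> \<rho> k"
    "\<And>k. \<bar>k\<bar> < \<epsilon> \<Longrightarrow> \<bar>k * mass_const \<Omega> \<rho> k\<bar> < \<eta>"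
    "\<And>k. \<bar>k\<bar> < \<epsilon> \<Longrightarrow> mass_const \<Omega> \<rho> k * bose_integral (\<lambda>_::real^'n. 1) (k * mass_const \<Omega> \<rho> k)
       = \<rho> / measure lborel \<Omega>"
proof -
  define G where "G = bose_integral (\<lambda>_::real^'n. 1)"
  define a where "a = G 0"
  define r where "r = \<rho> / measure lborel \<Omega>"
  have a: "a = (LINT v|lborel. gauss (v::real^'n))" by (simp add: a_def G_def bose_integral_def)
  have a_pos: "0 < a" unfolding a by (rule integral_gauss_pos)
  have r: "0 < r" using V \<rho> by (simp add: r_def)
  define C0 where "C0 = r / a"
  have C0: "0 < C0" using r a_pos by (simp add: C0_def)
  have lip: "\<bar>G u - G u'\<bar> \<le> 4 * a * \<bar>u - u'\<bar>" if "\<bar>u\<bar> \<le> 1 / 2" "\<bar>u'\<bar> \<le> 1 / 2" for u u'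
    using bose_integral_lipschitz[OF that, where 'a="real^'n"] by (simp add: G_def a)
  \<comment> \<open>The cap \<open>1/16\<close> turns the Lipschitz constant \<open>4 * a\<close> into a deviation of at most \<open>a / 4\<close>.\<close>
  define b where "b = Min {\<eta>, 1 / 16}"
  have b: "0 < b" "b \<le> \<eta>" "b \<le> 1 / 16" using \<eta> by (auto simp: b_def)
  define \<epsilon> where "\<epsilon> = b / (2 * C0)"
  have main: "0 < mass_const \<Omega> \<rho> k \<and> \<bar>k * mass_const \<Omega> \<rho> k\<bar> < \<eta> \<and>
      mass_const \<Omega> \<rho> k * G (k * mass_const \<Omega> \<rho> k) = r" if k: "\<bar>k\<bar> < \<epsilon>" for k
  proof -
    have kC: "\<bar>k * C\<bar> < b" if "0 < C" "C \<le> 2 * C0" for C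
    proof -
      have "\<bar>k * C\<bar> \<le> \<bar>k\<bar> * (2 * C0)" using that by (simp add: abs_mult mult_left_mono)
      also have "\<dots> < \<epsilon> * (2 * C0)" using k C0 by (intro mult_strict_right_mono) auto
      also have "\<dots> = b" using C0 by (simp add: \<epsilon>_def)
      finally show ?thesis .
    qed
    have G_near: "\<bar>G (k * C) - a\<bar> \<le> a / 4" if "0 < C" "C \<le> 2 * C0" for C
    proof -
      have "\<bar>G (k * C) - G 0\<bar> \<le> 4 * a * \<bar>k * C\<bar>" using lip[of "k * C" 0] kC[OF that] b by simp
      also have "\<dots> \<le> 4 * a * (1 / 16)" using kC[OF that] b a_pos by (intro mult_left_mono) auto
      finally show ?thesis by (simp add: a_def)
    qed
    have "(4 * a * \<bar>k\<bar>)-lipschitz_on {C0 / 2..2 * C0} (\<lambda>C. G (k * C))"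
    proof (rule lipschitz_onI)
      fix C C' assume "C \<in> {C0 / 2..2 * C0}" "C' \<in> {C0 / 2..2 * C0}"
      then have "\<bar>k * C\<bar> \<le> 1 / 2" "\<bar>k * C'\<bar> \<le> 1 / 2"
        using kC[of C] kC[of C'] b C0 by auto
      from lip[OF this] show "dist (G (k * C)) (G (k * C')) \<le> 4 * a * \<bar>k\<bar> * dist C C'"
        by (simp add: dist_real_def abs_mult flip: right_diff_distrib)
    qed (use a_pos in auto)
    then have cont: "continuous_on {C0 / 2..2 * C0} (\<lambda>C. C * G (k * C))"
      by (intro continuous_intros lipschitz_on_continuous_on)
    have "C0 / 2 * G (k * (C0 / 2)) \<le> C0 / 2 * (2 * a)"
      using abs_le_D1[OF G_near[of "C0 / 2"]] C0 a_pos by (intro mult_left_mono) auto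
    then have lo: "C0 / 2 * G (k * (C0 / 2)) \<le> r" using a_pos by (simp add: C0_def)
    have "2 * C0 * (a / 2) \<le> 2 * C0 * G (k * (2 * C0))"
      using abs_le_D2[OF G_near[of "2 * C0"]] C0 a_pos by (intro mult_left_mono) auto
    then have hi: "r \<le> 2 * C0 * G (k * (2 * C0))" using a_pos by (simp add: C0_def)
    obtain C where C: "C0 / 2 \<le> C" "C \<le> 2 * C0" "C * G (k * C) = r"
      using IVT'[of "\<lambda>C. C * G (k * C)" "C0 / 2" r "2 * C0", OF lo hi _ cont] C0 by auto
    have C_pos: "0 < C" using C C0 by linarith
    have kC': "\<bar>k * C\<bar> < b" using kC C C_pos by blast
    have "mass_const \<Omega> \<rho> k = C"
    proof (rule mass_const_eqI[OF V C_pos])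
      show "k * C < 1" using kC' b by linarith
      show "measure lborel \<Omega> * (LINT v|lborel. maxwellian k C (v::real^'n)) = \<rho>"
        using C(3) V by (simp add: integral_maxwellian r_def flip: G_def)
    qed
    then show ?thesis using C C_pos kC' b by auto
  qed
  moreover have "0 < \<epsilon>" using b C0 by (simp add: \<epsilon>_def)
  ultimately show ?thesis using that unfolding G_def r_def by blast
qed

lemma has_real_derivative_pos_nbhd:
  fixes f :: "real \<Rightarrow> real"
  assumes "(f has_real_derivative D) (at 0)" "0 < D"
  obtains \<delta> where "0 < \<delta>" "\<And>u. 0 < u \<Longrightarrow> u < \<delta> \<Longrightarrow> f 0 < f u"
    "\<And>u. - \<delta> < u \<Longrightarrow> u < 0 \<Longrightarrow> f u < f 0"
proof -
  obtain d1 where d1: "0 < d1" "\<And>h. 0 < h \<Longrightarrow> h < d1 \<Longrightarrow> f 0 < f h"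
    using DERIV_pos_inc_right[OF assms] by auto
  obtain d2 where d2: "0 < d2" "\<And>h. 0 < h \<Longrightarrow> h < d2 \<Longrightarrow> f (- h) < f 0"
    using DERIV_pos_inc_left[OF assms] by auto
  show ?thesis
  proof (rule that[of "min d1 d2"])
    show "f u < f 0" if "- min d1 d2 < u" "u < 0" for u
      using d2(2)[of "- u"] that by auto
  qed (use d1 d2 in auto)
qed

section \<open>Comparison of the equilibria\<close>

theorem corollary2p14:
  fixes \<Omega> :: "(real^'n) set" and \<rho> :: real
  assumes "open \<Omega>" and "connected \<Omega>" and "\<Omega> \<noteq> {}" and "bounded \<Omega>"
    and "\<rho> > 0"
  shows "\<exists>\<epsilon>>0.
    (\<forall>k. 0 < k \<and> k < \<epsilon> \<longrightarrow>
       energy \<Omega> (equilibrium \<Omega> \<rho> k) < energy \<Omega> (equilibrium \<Omega> \<rho> 0) \<and>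
       (CARD('n) > 2 \<longrightarrow>
          entropy \<Omega> k (equilibrium \<Omega> \<rho> k) < entropy \<Omega> 0 (equilibrium \<Omega> \<rho> 0)) \<and>
       free_energy \<Omega> 0 (equilibrium \<Omega> \<rho> 0) < free_energy \<Omega> k (equilibrium \<Omega> \<rho> k)) \<and>
    (\<forall>k. - \<epsilon> < k \<and> k < 0 \<longrightarrow>
       energy \<Omega> (equilibrium \<Omega> \<rho> 0) < energy \<Omega> (equilibrium \<Omega> \<rho> k) \<and>
       (CARD('n) > 2 \<longrightarrow>
          entropy \<Omega> 0 (equilibrium \<Omega> \<rho> 0) < entropy \<Omega> k (equilibrium \<Omega> \<rho> k)) \<and>
       free_energy \<Omega> k (equilibrium \<Omega> \<rho> k) < free_energy \<Omega> 0 (equilibrium \<Omega> \<rho> 0))"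
proof -
  define V where "V = measure lborel \<Omega>"
  have \<Omega>: "\<Omega> \<in> sets lborel" "emeasure lborel \<Omega> \<noteq> \<infinity>"
    using assms emeasure_bounded_finite[of \<Omega>] by auto
  have V: "0 < V" unfolding V_def using assms \<Omega> by (intro measure_lborel_open_pos)
  define G where "G = bose_integral (\<lambda>_::real^'n. 1)"
  define L where "L = bose_integral (\<lambda>v::real^'n. (norm v)\<^sup>2 / 2)"
  define K where "K u = (LINT v|lborel. bose_log u (gauss (v::real^'n)))" for u
  define a where "a = (LINT v|lborel. gauss (v::real^'n))"
  define n where "n = real CARD('n)"
  define d where "d = 1 / sqrt 2 ^ CARD('n)"
  have a: "0 < a" unfolding a_def by (rule integral_gauss_pos)
  have n: "0 < n" by (simp add: n_def)
  have d: "0 < d" by (simp add: d_def)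
  have G0: "G 0 = a" by (simp add: G_def bose_integral_def a_def)
  have L0: "L 0 = n / 2 * a"
    using integral_energy_gauss[where 'a="real^'n"] by (simp add: L_def bose_integral_def a_def n_def)
  have K0: "K 0 = a" by (simp add: K_def bose_log_def a_def)
  have G': "(G has_real_derivative a * d) (at 0)"
    using has_real_derivative_bose_integral[of "\<lambda>_::real^'n. 1"]
    by (simp add: G_def a_def d_def integral_gauss_square)
  have L': "(L has_real_derivative n / 2 * a * d / 2) (at 0)"
    using has_real_derivative_bose_integral[of "\<lambda>v::real^'n. (norm v)\<^sup>2 / 2"]
    unfolding integral_energy_gauss_square integral_energy_gauss L_def
    by (simp add: a_def d_def n_def integrable_energy_gauss[simplified])
  have K': "(K has_real_derivative a * d / 2) (at 0)"
    using has_real_derivative_integral_bose_log[where 'a="real^'n"]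
    by (simp add: K_def[abs_def] a_def d_def integral_gauss_square)

  \<comment> \<open>Up to increasing affine maps these are minus the energy, the free energy and minus the
    entropy, as functions of \<open>u = k * C k\<close> after eliminating \<open>C k\<close> through the mass equation.\<close>
  define e where "e u = - (L u / G u)" for u
  define \<phi> where "\<phi> u = ln (G u) + K u / G u" for u
  define \<sigma> where "\<sigma> u = e u - \<phi> u" for u
  have e': "(e has_real_derivative n * d / 4) (at 0)"
    unfolding e_def[abs_def]
    by (rule derivative_eq_intros G' L' refl | use a in \<open>simp add: G0 L0 field_simps\<close>)+
  have \<phi>': "(\<phi> has_real_derivative d / 2) (at 0)"
    unfolding \<phi>_def[abs_def]
    by (rule derivative_eq_intros G' K' refl | use a in \<open>simp add: G0 K0 field_simps\<close>)+
  have \<sigma>': "(\<sigma> has_real_derivative (n - 2) * d / 4) (at 0)"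
    unfolding \<sigma>_def[abs_def]
    by (rule derivative_eq_intros e' \<phi>' refl | simp add: field_simps)+

  have "0 < n * d / 4" "0 < d / 2" using n d by auto
  obtain \<delta>1 where \<delta>1: "0 < \<delta>1" "\<And>u. 0 < u \<Longrightarrow> u < \<delta>1 \<Longrightarrow> e 0 < e u"
    "\<And>u. - \<delta>1 < u \<Longrightarrow> u < 0 \<Longrightarrow> e u < e 0"
    using has_real_derivative_pos_nbhd[OF e' \<open>0 < n * d / 4\<close>] by metis
  obtain \<delta>2 where \<delta>2: "0 < \<delta>2" "\<And>u. 0 < u \<Longrightarrow> u < \<delta>2 \<Longrightarrow> \<phi> 0 < \<phi> u"
    "\<And>u. - \<delta>2 < u \<Longrightarrow> u < 0 \<Longrightarrow> \<phi> u < \<phi> 0"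
    using has_real_derivative_pos_nbhd[OF \<phi>' \<open>0 < d / 2\<close>] by metis
  obtain \<delta>3 where \<delta>3: "0 < \<delta>3" "\<And>u. CARD('n) > 2 \<Longrightarrow> 0 < u \<Longrightarrow> u < \<delta>3 \<Longrightarrow> \<sigma> 0 < \<sigma> u"
    "\<And>u. CARD('n) > 2 \<Longrightarrow> - \<delta>3 < u \<Longrightarrow> u < 0 \<Longrightarrow> \<sigma> u < \<sigma> 0"
  proof (cases "CARD('n) > 2")
    case True
    then have "0 < (n - 2) * d / 4" using d by (simp add: n_def)
    then show ?thesis using has_real_derivative_pos_nbhd[OF \<sigma>'] that by metis
  qed (use that[of 1] in auto)
  define \<eta> where "\<eta> = Min {\<delta>1, \<delta>2, \<delta>3, 1 / 2}"
  have \<eta>: "0 < \<eta>" "\<eta> \<le> \<delta>1" "\<eta> \<le> \<delta>2" "\<eta> \<le> \<delta>3" "\<eta> \<le> 1 / 2"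
    using \<delta>1 \<delta>2 \<delta>3 by (auto simp: \<eta>_def)
  define C where "C k = mass_const \<Omega> \<rho> k" for k
  obtain \<epsilon> where \<epsilon>: "0 < \<epsilon>" "\<And>k. \<bar>k\<bar> < \<epsilon> \<Longrightarrow> 0 < C k"
    "\<And>k. \<bar>k\<bar> < \<epsilon> \<Longrightarrow> \<bar>k * C k\<bar> < \<eta>"
    "\<And>k. \<bar>k\<bar> < \<epsilon> \<Longrightarrow> C k * G (k * C k) = \<rho> / V"
    using mass_const_near_0[OF V[unfolded V_def] \<open>\<rho> > 0\<close> \<eta>(1)] unfolding C_def G_def V_def by metis

  have E: "energy \<Omega> (equilibrium \<Omega> \<rho> k) = - (\<rho> * e (k * C k))"
    and S: "entropy \<Omega> k (equilibrium \<Omega> \<rho> k) = - (\<rho> * (ln (\<rho> / V) + 1 + \<sigma> (k * C k)))"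
    and F: "free_energy \<Omega> k (equilibrium \<Omega> \<rho> k) = \<rho> * (\<phi> (k * C k) - ln (\<rho> / V) - 1)"
    if k: "\<bar>k\<bar> < \<epsilon>" for k
  proof -
    define u where "u = k * C k"
    have mass: "C k * G u = \<rho> / V" using \<epsilon>(4)[OF k] by (simp add: u_def)
    have Cpos: "0 < C k" using \<epsilon>(2)[OF k] .
    have "0 < C k * G u" unfolding mass using V \<open>\<rho> > 0\<close> by simp
    then have Gpos: "0 < G u" using Cpos by (simp add: zero_less_mult_iff)
    have C: "V * C k = \<rho> / G u" using mass V Gpos by (simp add: field_simps)
    have lnC: "ln (C k) = ln (\<rho> / V) - ln (G u)"
      unfolding mass[symmetric] using Cpos Gpos by (simp add: ln_mult)
    have u: "\<bar>k * C k\<bar> \<le> 1 / 2" using \<epsilon>(3)[OF k] \<eta>(5) by linarith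
    have "energy \<Omega> (equilibrium \<Omega> \<rho> k) = V * C k * L u"
      using energy_equilibrium[OF \<Omega> C_def[symmetric]] by (simp add: V_def L_def u_def)
    then show E: "energy \<Omega> (equilibrium \<Omega> \<rho> k) = - (\<rho> * e (k * C k))"
      unfolding C by (simp add: e_def u_def)
    have "entropy \<Omega> k (equilibrium \<Omega> \<rho> k) = - (V * C k * ((ln (C k) + 1) * G u - L u - K u))"
      using entropy_equilibrium[OF \<Omega> C_def[symmetric] Cpos u]
      by (simp add: V_def G_def L_def K_def u_def mult.assoc)
    also have "\<dots> = - (\<rho> * (ln (\<rho> / V) + 1 + \<sigma> u))"
      unfolding C lnC \<sigma>_def e_def \<phi>_def using Gpos by (simp add: field_simps)
    finally show S: "entropy \<Omega> k (equilibrium \<Omega> \<rho> k) = - (\<rho> * (ln (\<rho> / V) + 1 + \<sigma> (k * C k)))"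
      by (simp add: u_def)
    show "free_energy \<Omega> k (equilibrium \<Omega> \<rho> k) = \<rho> * (\<phi> (k * C k) - ln (\<rho> / V) - 1)"
      unfolding free_energy_def S E \<sigma>_def by (simp add: algebra_simps)
  qed
  have u_pos: "0 < k * C k \<and> k * C k < \<eta>" if "0 < k" "k < \<epsilon>" for k
    using \<epsilon>(2,3)[of k] that by auto
  have u_neg: "- \<eta> < k * C k \<and> k * C k < 0" if "- \<epsilon> < k" "k < 0" for k
    using \<epsilon>(2,3)[of k] that by (auto simp: mult_neg_pos)
  note classical = E[of 0] S[of 0] F[of 0]
  show ?thesis
  proof (intro exI[of _ \<epsilon>] conjI allI impI)
    show "0 < \<epsilon>" by fact
  next
    fix k assume "0 < k \<and> k < \<epsilon>"
    then have k: "\<bar>k\<bar> < \<epsilon>" and u: "0 < k * C k" "k * C k < \<eta>" using u_pos by auto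
    note [simp] = E[OF k] S[OF k] F[OF k] classical
    show "energy \<Omega> (equilibrium \<Omega> \<rho> k) < energy \<Omega> (equilibrium \<Omega> \<rho> 0)"
      using \<delta>1(2)[of "k * C k"] u \<eta> \<epsilon>(1) \<open>\<rho> > 0\<close> by simp
    show "entropy \<Omega> k (equilibrium \<Omega> \<rho> k) < entropy \<Omega> 0 (equilibrium \<Omega> \<rho> 0)" if "CARD('n) > 2"
      using \<delta>3(2)[of "k * C k", OF that] u \<eta> \<epsilon>(1) \<open>\<rho> > 0\<close> by simp
    show "free_energy \<Omega> 0 (equilibrium \<Omega> \<rho> 0) < free_energy \<Omega> k (equilibrium \<Omega> \<rho> k)"
      using \<delta>2(2)[of "k * C k"] u \<eta> \<epsilon>(1) \<open>\<rho> > 0\<close> by simp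
  next
    fix k assume "- \<epsilon> < k \<and> k < 0"
    then have k: "\<bar>k\<bar> < \<epsilon>" and u: "- \<eta> < k * C k" "k * C k < 0" using u_neg by auto
    note [simp] = E[OF k] S[OF k] F[OF k] classical
    show "energy \<Omega> (equilibrium \<Omega> \<rho> 0) < energy \<Omega> (equilibrium \<Omega> \<rho> k)"
      using \<delta>1(3)[of "k * C k"] u \<eta> \<epsilon>(1) \<open>\<rho> > 0\<close> by simp
    show "entropy \<Omega> 0 (equilibrium \<Omega> \<rho> 0) < entropy \<Omega> k (equilibrium \<Omega> \<rho> k)" if "CARD('n) > 2"
      using \<delta>3(3)[of "k * C k", OF that] u \<eta> \<epsilon>(1) \<open>\<rho> > 0\<close> by simp
    show "free_energy \<Omega> k (equilibrium \<Omega> \<rho> k) < free_energy \<Omega> 0 (equilibrium \<Omega> \<rho> 0)"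
      using \<delta>2(3)[of "k * C k"] u \<eta> \<epsilon>(1) \<open>\<rho> > 0\<close> by simp
  qed
qed

end
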